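(* Let $\vec{P}=(P_1,\dots,P_t)$ be an integral polynomial map in $D$ variables and fix $1\leqslant i\leqslant t$. Suppose that $\vec{P}$ is not algebraically independent of degree $s$ at index $i$. Then the true complexity of $\vec{P}$ at $i$ is at least $s$.
   Context: An integral polynomial map is a tuple $\vec{P}=(P_1,\dots,P_t)$ of integer-valued polynomials in $\mathbb{Q}[x_1,\dots,x_D]$ with zero constant terms; for large primes $p$ the values $P_j(\mathbf{x})$, $\mathbf{x}\in\mathbb{F}_p^D$, are interpreted mod $p$. $\vec{P}$ is algebraically independent of degree $s$ at $i$ if whenever $Q_1(P_1(\mathbf{x}))+\dots+Q_t(P_t(\mathbf{x}))=0$ identically for some $Q_1,\dots,Q_t\in\mathbb{Z}[y]$, the polynomial $Q_i$ has degree at most $s-1$. A function $f:\mathbb{F}_p\to\mathbb{C}$ is 1-bounded if $|f|\leqslant 1$. Gowers norms: $\|f\|_{U^k}=\left(\mathbb{E}_{x,h_1,\dots,h_k\in\mathbb{F}_p}\prod_{w\in\{0,1\}^k}\mathcal{C}^{|w|}f(x+\sum w_jh_j)\right)^{1/2^k}$. $\vec{P}$ has true complexity $r$ at index $i$ if $r$ is the smallest natural number such that for every $\epsilon>0$ there exist $\delta>0$ and $p_0$ such that for all primes $p>p_0$ and all 1-bounded $f_1,\dots,f_t:\mathbb{F}_p\to\mathbb{C}$ with $\|f_i\|_{U^{r+1}}<\delta$ we have $|\mathbb{E}_{\mathbf{x}\in\mathbb{F}_p^D}f_1(P_1(\mathbf{x}))\cdots f_t(P_t(\mathbf{x}))|<\epsilon$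 (and $\infty$ if no such $r$ exists). *)

theory Defs
  imports
    "HOL-Library.Poly_Mapping"
    "HOL-Library.Extended_Nat"
    "HOL-Library.FuncSet"
    "HOL-Computational_Algebra.Polynomial"
    "HOL-Computational_Algebra.Primes"
    "HOL-Number_Theory.Cong"
    Complex_Main
begin

text \<open>
  Elements of \<open>\<rat>[x\<^sub>1, x\<^sub>2, \<dots>]\<close>: finitely supported maps from exponent vectors to coefficients, with
  the convolution product of \<^theory>\<open>HOL-Library.Poly_Mapping\<close> as multiplication.
\<close>
type_synonym rat_mpoly = "(nat \<Rightarrow>\<^sub>0 nat) \<Rightarrow>\<^sub>0 rat"

definition mpoly_in_vars :: "nat \<Rightarrow> rat_mpoly \<Rightarrow> bool" where
  "mpoly_in_vars D P \<longleftrightarrow> (\<forall>m \<in> Poly_Mapping.keys P. Poly_Mapping.keys m \<subseteq> {1..D})"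

definition mpoly_eval :: "(nat \<Rightarrow> rat) \<Rightarrow> rat_mpoly \<Rightarrow> rat" where
  "mpoly_eval x P =
     (\<Sum>m \<in> Poly_Mapping.keys P. Poly_Mapping.lookup P m *
       (\<Prod>v \<in> Poly_Mapping.keys m. x v ^ Poly_Mapping.lookup m v))"

definition integer_valued :: "rat_mpoly \<Rightarrow> bool" where
  "integer_valued P \<longleftrightarrow> (\<forall>x :: nat \<Rightarrow> int. mpoly_eval (\<lambda>v. of_int (x v)) P \<in> \<int>)"

definition integral_polynomial_map :: "nat \<Rightarrow> nat \<Rightarrow> (nat \<Rightarrow> rat_mpoly) \<Rightarrow> bool" where
  "integral_polynomial_map D t P \<longleftrightarrow>
     (\<forall>j \<in> {1..t}. mpoly_in_vars D (P j) \<and> integer_valued (P j) \<and> Poly_Mapping.lookup (P j) 0 = 0)"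

text \<open>
  The relation is an identity in the polynomial ring. A zero \<open>Q i\<close> counts as having degree
  \<open>- \<infinity>\<close>, whereas the library sets \<open>degree 0 = 0\<close>.
\<close>
definition alg_independent_at :: "nat \<Rightarrow> (nat \<Rightarrow> rat_mpoly) \<Rightarrow> nat \<Rightarrow> nat \<Rightarrow> bool" where
  "alg_independent_at t P s i \<longleftrightarrow>
     (\<forall>Q :: nat \<Rightarrow> int poly.
        (\<Sum>j = 1..t. poly (map_poly of_int (Q j)) (P j)) = 0 \<longrightarrow>
        Q i = 0 \<or> int (degree (Q i)) \<le> int s - 1)"

text \<open>
  The field \<open>\<F>\<^sub>p\<close> is represented by the residues \<open>{0..<p}\<close>; a function on it is a function on
  \<^typ>\<open>int\<close> of which only the values on these residues are ever used.
\<close>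
abbreviation residues_mod :: "nat \<Rightarrow> int set" where
  "residues_mod p \<equiv> {0..<int p}"

definition one_bounded :: "nat \<Rightarrow> (int \<Rightarrow> complex) \<Rightarrow> bool" where
  "one_bounded p f \<longleftrightarrow> (\<forall>x \<in> residues_mod p. cmod (f x) \<le> 1)"

definition expect :: "'a set \<Rightarrow> ('a \<Rightarrow> complex) \<Rightarrow> complex" where
  "expect A g = (\<Sum>a \<in> A. g a) / of_nat (card A)"

text \<open>
  For \<open>k \<ge> 1\<close> the average is a nonnegative real number, so taking the real part only changes
  the type.
\<close>
definition gowers_norm :: "nat \<Rightarrow> nat \<Rightarrow> (int \<Rightarrow> complex) \<Rightarrow> real" where
  "gowers_norm p k f =
     root (2 ^ k) (Re (expect (residues_mod p \<times> ({1..k} \<rightarrow>\<^sub>E residues_mod p))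
       (\<lambda>(x, h). \<Prod>w \<in> {1..k} \<rightarrow>\<^sub>E {0, 1::nat}.
          (cnj ^^ (\<Sum>j = 1..k. w j)) (f ((x + (\<Sum>j = 1..k. int (w j) * h j)) mod int p)))))"

text \<open>
  The value is computed at the representatives of \<open>x\<close> in \<open>{0..<p}\<close>. The floor only converts an
  integer of type \<^typ>\<open>rat\<close> to \<^typ>\<open>int\<close>. As \<open>value_mod_well_defined\<close> below shows, for large \<open>p\<close> the
  choice of representatives is irrelevant; small \<open>p\<close> play no role in the true complexity.
\<close>
definition value_mod :: "nat \<Rightarrow> rat_mpoly \<Rightarrow> (nat \<Rightarrow> int) \<Rightarrow> int" where
  "value_mod p P x = \<lfloor>mpoly_eval (\<lambda>v. of_int (x v)) P\<rfloor> mod int p"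

lemma value_mod_well_defined:
  assumes iv: "integer_valued P" and vars: "mpoly_in_vars D P"
  shows "\<exists>p0. \<forall>p > p0. prime p \<longrightarrow>
           (\<forall>x y. (\<forall>v \<in> {1..D}. [x v = y v] (mod int p)) \<longrightarrow> value_mod p P x = value_mod p P y)"
proof -
  define den where "den m = snd (quotient_of (Poly_Mapping.lookup P m))" for m
  define N where "N = (\<Prod>m \<in> Poly_Mapping.keys P. den m)"
  define c where "c m = fst (quotient_of (Poly_Mapping.lookup P m)) * (\<Prod>m' \<in> Poly_Mapping.keys P - {m}. den m')" for m
  have den_pos: "den m > 0" for m
    by (simp add: den_def quotient_of_denom_pos')
  have N_pos: "N > 0"
    by (simp add: N_def prod_pos den_pos)
  have coeff: "of_int N * Poly_Mapping.lookup P m = of_int (c m)" if "m \<in> Poly_Mapping.keys P" for m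
  proof -
    have "Poly_Mapping.lookup P m = of_int (fst (quotient_of (Poly_Mapping.lookup P m))) / of_int (den m)"
      unfolding den_def by (rule quotient_of_div) simp
    moreover have "N = den m * (\<Prod>m' \<in> Poly_Mapping.keys P - {m}. den m')"
      unfolding N_def using that by (intro prod.remove) auto
    ultimately show ?thesis
      using den_pos[of m] by (simp add: c_def field_simps)
  qed
  have eval: "N * \<lfloor>mpoly_eval (\<lambda>v. of_int (x v)) P\<rfloor>
                = (\<Sum>m \<in> Poly_Mapping.keys P. c m * (\<Prod>v \<in> Poly_Mapping.keys m. x v ^ Poly_Mapping.lookup m v))" for x :: "nat \<Rightarrow> int"
  proof -
    have "rat_of_int (N * \<lfloor>mpoly_eval (\<lambda>v. of_int (x v)) P\<rfloor>)
            = of_int N * mpoly_eval (\<lambda>v. of_int (x v)) P"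
      using iv by (simp add: integer_valued_def)
    also have "\<dots> = (\<Sum>m \<in> Poly_Mapping.keys P. of_int (c m) * (\<Prod>v \<in> Poly_Mapping.keys m. of_int (x v) ^ Poly_Mapping.lookup m v))"
      unfolding mpoly_eval_def sum_distrib_left
      by (intro sum.cong refl) (simp add: coeff mult.assoc[symmetric])
    also have "\<dots> = of_int (\<Sum>m \<in> Poly_Mapping.keys P. c m * (\<Prod>v \<in> Poly_Mapping.keys m. x v ^ Poly_Mapping.lookup m v))"
      by simp
    finally show ?thesis
      by (simp only: of_int_eq_iff)
  qed
  show ?thesis
  proof (intro exI[of _ "nat N"] allI impI)
    fix p :: nat and x y :: "nat \<Rightarrow> int"
    assume p: "p > nat N" "prime p" and xy: "\<forall>v \<in> {1..D}. [x v = y v] (mod int p)"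
    have "\<not> int p dvd N"
      using p N_pos zdvd_imp_le[of "int p" N] by auto
    then have cop: "coprime N (int p)"
      using p prime_imp_coprime[of "int p" N] by (simp add: coprime_commute)
    have "[(\<Sum>m \<in> Poly_Mapping.keys P. c m * (\<Prod>v \<in> Poly_Mapping.keys m. x v ^ Poly_Mapping.lookup m v))
            = (\<Sum>m \<in> Poly_Mapping.keys P. c m * (\<Prod>v \<in> Poly_Mapping.keys m. y v ^ Poly_Mapping.lookup m v))] (mod int p)"
      using vars xy unfolding mpoly_in_vars_def
      by (intro cong_sum cong_mult cong_refl cong_prod cong_pow) blast
    then have "[N * \<lfloor>mpoly_eval (\<lambda>v. of_int (x v)) P\<rfloor>
                 = N * \<lfloor>mpoly_eval (\<lambda>v. of_int (y v)) P\<rfloor>] (mod int p)"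
      by (simp only: eval)
    then show "value_mod p P x = value_mod p P y"
      using cop by (simp add: cong_mult_lcancel value_mod_def cong_def[symmetric])
  qed
qed

definition gowers_controlled_at :: "nat \<Rightarrow> nat \<Rightarrow> (nat \<Rightarrow> rat_mpoly) \<Rightarrow> nat \<Rightarrow> nat \<Rightarrow> bool" where
  "gowers_controlled_at D t P i r \<longleftrightarrow>
     (\<forall>\<epsilon> > 0. \<exists>\<delta> > 0. \<exists>p0. \<forall>p > p0. prime p \<longrightarrow>
        (\<forall>f :: nat \<Rightarrow> int \<Rightarrow> complex.
           (\<forall>j \<in> {1..t}. one_bounded p (f j)) \<longrightarrow> gowers_norm p (r + 1) (f i) < \<delta> \<longrightarrow>
           cmod (expect ({1..D} \<rightarrow>\<^sub>E residues_mod p) (\<lambda>x. \<Prod>j = 1..t. f j (value_mod p (P j) x))) < \<epsilon>))"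

definition true_complexity :: "nat \<Rightarrow> nat \<Rightarrow> (nat \<Rightarrow> rat_mpoly) \<Rightarrow> nat \<Rightarrow> enat" where
  "true_complexity D t P i =
     (if \<exists>r. gowers_controlled_at D t P i r
      then enat (LEAST r. gowers_controlled_at D t P i r) else \<infinity>)"

end

theory Submission
  imports Defs "HOL-Analysis.Convex"
begin

text \<open>
  Take a relation \<open>Q\<^sub>1(P\<^sub>1) + \<dots> + Q\<^sub>t(P\<^sub>t) = 0\<close> with \<open>deg Q\<^sub>i = d \<ge> s\<close> and put
  \<open>f\<^sub>j(x) = e(Q\<^sub>j(x) / p)\<close>. The product \<open>f\<^sub>1(P\<^sub>1(x)) \<cdots> f\<^sub>t(P\<^sub>t(x))\<close> is identically \<open>1\<close>. On the
  other hand, each multiplicative derivative of \<open>f\<^sub>i\<close> in a nonzero direction lowers the degree of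
  the phase by exactly one when \<open>p\<close> is large, so \<open>\<parallel>f\<^sub>i\<parallel>\<close> in \<open>U\<^sup>d\<close> tends to \<open>0\<close> with \<open>p \<rightarrow> \<infinity>\<close>, and by
  monotonicity of the Gowers norms so does the \<open>U\<^sup>k\<close> norm for all \<open>k \<le> d\<close>.
\<close>

subsection \<open>Evaluation is a ring homomorphism\<close>

lemma mpoly_eval_0 [simp]: "mpoly_eval x 0 = 0"
  by (simp add: mpoly_eval_def)

lemma mpoly_eval_add [simp]: "mpoly_eval x (P + Q) = mpoly_eval x P + mpoly_eval x Q"
  unfolding mpoly_eval_def
  by (rule setsum_keys_plus_distrib) (simp_all add: ring_distribs)

lemma mpoly_eval_single:
  "mpoly_eval x (Poly_Mapping.single m c) =
     c * (\<Prod>v \<in> Poly_Mapping.keys m. x v ^ Poly_Mapping.lookup m v)"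
  by (simp add: mpoly_eval_def)

lemma mpoly_eval_sum: "mpoly_eval x (\<Sum>j \<in> A. P j) = (\<Sum>j \<in> A. mpoly_eval x (P j))"
  by (induction A rule: infinite_finite_induct) simp_all

lemma monomial_eval_add:
  fixes x :: "'a \<Rightarrow> 'b :: comm_semiring_1" and m n :: "'a \<Rightarrow>\<^sub>0 nat"
  shows "(\<Prod>v \<in> Poly_Mapping.keys (m + n). x v ^ Poly_Mapping.lookup (m + n) v) =
     (\<Prod>v \<in> Poly_Mapping.keys m. x v ^ Poly_Mapping.lookup m v) *
     (\<Prod>v \<in> Poly_Mapping.keys n. x v ^ Poly_Mapping.lookup n v)"
proof -
  \<comment> \<open>Enlarging every index set to the union of the two supports only adds factors
    with exponent 0; over a common set the exponents add pointwise.\<close>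
  let ?A = "Poly_Mapping.keys m \<union> Poly_Mapping.keys n"
  have extend: "(\<Prod>v \<in> Poly_Mapping.keys l. x v ^ Poly_Mapping.lookup l v) =
      (\<Prod>v \<in> ?A. x v ^ Poly_Mapping.lookup l v)" if "Poly_Mapping.keys l \<subseteq> ?A" for l :: "'a \<Rightarrow>\<^sub>0 nat"
    by (rule prod.mono_neutral_left) (use that in \<open>auto simp: in_keys_iff\<close>)
  show ?thesis
    by (subst (1 2 3) extend)
      (auto simp: Poly_Mapping.keys_add lookup_add power_add prod.distrib)
qed

text \<open>Updating a key outside the support is the same as adding a single term. This reduces
  statements additive in a polynomial to monomials.\<close>

lemma poly_mapping_single_add_induct [case_names zero add_single]:
  assumes "\<Phi> 0"
    and "\<And>f k c. \<Phi> f \<Longrightarrow> \<Phi> (f + Poly_Mapping.single k c)"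
  shows "\<Phi> (f :: 'a \<Rightarrow>\<^sub>0 'b :: comm_monoid_add)"
proof (induction f rule: update_induct)
  case const
  show ?case by (fact assms(1))
next
  case (update f a b)
  have "Poly_Mapping.update a b f = f + Poly_Mapping.single a b"
    using update(1)
    by (intro poly_mapping_eqI) (auto simp: lookup_update lookup_add lookup_single in_keys_iff when_def)
  with assms(2)[OF update(3)] show ?case by simp
qed

lemma mpoly_eval_mult [simp]: "mpoly_eval x (P * Q) = mpoly_eval x P * mpoly_eval x Q"
proof (induction P rule: poly_mapping_single_add_induct)
  case zero
  show ?case by simp
next
  case (add_single P k c)
  \<comment> \<open>With a single monomial on the left, a second induction on \<open>Q\<close>
    leaves only products of two monomials.\<close>
  have "mpoly_eval x (Poly_Mapping.single k c * Q) =
      mpoly_eval x (Poly_Mapping.single k c) * mpoly_eval x Q"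
    by (induction Q rule: poly_mapping_single_add_induct)
      (simp_all add: distrib_left mult_single mpoly_eval_single monomial_eval_add ac_simps)
  with add_single show ?case by (simp add: distrib_right)
qed

lemma mpoly_eval_of_int [simp]: "mpoly_eval x (of_int n) = of_int n"
proof -
  have "of_int n = (Poly_Mapping.single 0 (of_int n) :: rat_mpoly)"
    by (simp add: single_of_int)
  then show ?thesis by (simp only: mpoly_eval_single) simp
qed

lemma mpoly_eval_poly:
  "mpoly_eval x (poly (map_poly of_int q) P) = poly (map_poly of_int q) (mpoly_eval x P)"
  by (induction q) (simp_all add: map_poly_pCons)

lemma poly_map_poly_of_int:
  "poly (map_poly of_int q) (of_int y :: 'a :: comm_ring_1) = of_int (poly q y)"
  by (induction q) (simp_all add: map_poly_pCons)

text \<open>Evaluation carries the identity of polynomials to every integer point, where the floor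
  is exact because each \<open>P j\<close> is integer-valued. The result is an identity in the
  integers, ready for reduction mod \<open>p\<close>.\<close>

lemma relation_at_integer_point:
  fixes Q :: "nat \<Rightarrow> int poly" and x :: "nat \<Rightarrow> int"
  assumes "\<And>j. j \<in> A \<Longrightarrow> integer_valued (P j)"
    and "(\<Sum>j \<in> A. poly (map_poly of_int (Q j)) (P j)) = 0"
  shows "(\<Sum>j \<in> A. poly (Q j) \<lfloor>mpoly_eval (\<lambda>v. of_int (x v)) (P j)\<rfloor>) = 0"
proof -
  let ?ev = "mpoly_eval (\<lambda>v. of_int (x v))"
  have "rat_of_int (\<Sum>j \<in> A. poly (Q j) \<lfloor>?ev (P j)\<rfloor>) =
      (\<Sum>j \<in> A. poly (map_poly of_int (Q j)) (of_int \<lfloor>?ev (P j)\<rfloor>))"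
    by (simp add: poly_map_poly_of_int)
  also have "\<dots> = (\<Sum>j \<in> A. poly (map_poly of_int (Q j)) (?ev (P j)))"
    using assms(1) by (intro sum.cong refl) (simp add: integer_valued_def)
  also have "\<dots> = ?ev (\<Sum>j \<in> A. poly (map_poly of_int (Q j)) (P j))"
    by (simp add: mpoly_eval_sum mpoly_eval_poly)
  finally show ?thesis by (simp only: assms(2) mpoly_eval_0 of_int_eq_0_iff)
qed

subsection \<open>The additive character modulo \<open>p\<close>\<close>

definition add_char :: "nat \<Rightarrow> int \<Rightarrow> complex" where
  "add_char p n = cis (2 * pi * (of_int n / of_nat p))"

lemma add_char_0 [simp]: "add_char p 0 = 1"
  by (simp add: add_char_def)

lemma norm_add_char [simp]: "cmod (add_char p n) = 1"
  by (simp add: add_char_def)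

lemma add_char_add: "add_char p (m + n) = add_char p m * add_char p n"
  by (simp add: add_char_def cis_mult ring_distribs add_divide_distrib)

lemma cnj_add_char: "cnj (add_char p n) = add_char p (- n)"
  by (simp add: add_char_def cis_cnj)

lemma add_char_sum: "add_char p (\<Sum>j \<in> A. n j) = (\<Prod>j \<in> A. add_char p (n j))"
  by (induction A rule: infinite_finite_induct) (simp_all add: add_char_add)

lemma add_char_eq_1_iff:
  assumes "p > 0"
  shows "add_char p n = 1 \<longleftrightarrow> int p dvd n"
proof
  assume "int p dvd n"
  then obtain k where "n = int p * k" by (elim dvdE)
  then show "add_char p n = 1"
    using assms by (simp add: add_char_def)
next
  assume "add_char p n = 1"
  \<comment> \<open>The real part suffices: a cosine equals 1 only at integer multiples of 2
    pi.\<close>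
  then have "cos (2 * pi * (of_int n / of_nat p)) = 1"
    by (simp add: add_char_def complex_eq_iff)
  then obtain k :: int where "2 * pi * (of_int n / of_nat p) = of_int k * 2 * pi"
    by (auto simp: cos_one_2pi_int)
  then have "real_of_int n = real_of_int (k * int p)"
    using assms by (simp add: field_simps)
  then have "n = k * int p" by (simp only: of_int_eq_iff)
  then show "int p dvd n" by simp
qed

lemma add_char_cong:
  assumes "p > 0" "[m = n] (mod int p)"
  shows "add_char p m = add_char p n"
proof -
  have "add_char p (m - n) = 1"
    using assms by (simp add: add_char_eq_1_iff cong_iff_dvd_diff)
  then show ?thesis
    using add_char_add[of p "m - n" n] by simp
qed

lemma poly_cong:
  fixes q :: "int poly"
  assumes "[a = b] (mod m)"
  shows "[poly q a = poly q b] (mod m)"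
  by (induction q) (use assms in \<open>auto intro!: cong_add cong_mult\<close>)

lemma add_char_poly_mod:
  assumes "p > 0"
  shows "add_char p (poly q (y mod int p)) = add_char p (poly q y)"
  using assms by (intro add_char_cong poly_cong) simp_all

subsection \<open>Averages over residues\<close>

lemma sum_residues_shift:
  assumes "p > 0"
  shows "(\<Sum>x \<in> residues_mod p. g ((x + h) mod int p)) = (\<Sum>x \<in> residues_mod p. g x)"
  by (rule sum.reindex_bij_witness
      [where i = "\<lambda>x. (x - h) mod int p" and j = "\<lambda>x. (x + h) mod int p"])
    (use assms in \<open>auto simp: mod_simps\<close>)

text \<open>Cauchy-Schwarz. When \<open>card A = 0\<close>, division by zero makes both sides
  0.\<close>

lemma norm_expect_squared_le:
  "cmod (expect A g) ^ 2 \<le> (\<Sum>a \<in> A. cmod (g a) ^ 2) / card A"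
proof (cases "card A = 0")
  case True
  then show ?thesis by (auto simp: expect_def)
next
  case False
  have "cmod (\<Sum>a \<in> A. g a) ^ 2 \<le> (\<Sum>a \<in> A. cmod (g a)) ^ 2"
    by (intro power_mono norm_sum) simp
  also have "\<dots> \<le> (\<Sum>a \<in> A. cmod (g a) ^ 2) * card A"
    by (rule sum_squared_le_sum_of_squares)
  finally show ?thesis
    using False by (simp add: expect_def norm_divide power_divide field_simps power2_eq_square)
qed

text \<open>Translating the variable by 1 permutes the residues, yet multiplies the sum by
  \<open>add_char p a\<close>, which differs from 1; hence the sum vanishes.\<close>

lemma expect_linear_phase:
  assumes "p > 0" and "\<not> int p dvd a"
  shows "expect (residues_mod p) (\<lambda>x. add_char p (b + x * a)) = 0"
proof -
  let ?S = "\<Sum>x \<in> residues_mod p. add_char p (b + x * a)"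
  have "?S = (\<Sum>x \<in> residues_mod p. add_char p (b + ((x + 1) mod int p) * a))"
    by (rule sum_residues_shift[OF assms(1), symmetric])
  also have "\<dots> = (\<Sum>x \<in> residues_mod p. add_char p ((b + x * a) + a))"
  proof (intro sum.cong refl add_char_cong assms(1))
    fix x
    have "[(x + 1) mod int p = x + 1] (mod int p)" by simp
    then have "[b + ((x + 1) mod int p) * a = b + (x + 1) * a] (mod int p)"
      by (intro cong_add cong_mult cong_refl)
    then show "[b + ((x + 1) mod int p) * a = (b + x * a) + a] (mod int p)"
      by (simp add: algebra_simps)
  qed
  also have "\<dots> = ?S * add_char p a"
    by (simp add: add_char_add sum_distrib_right)
  finally have "?S * (add_char p a - 1) = 0" by (simp add: algebra_simps)
  then have "?S = 0"
    using assms by (simp add: add_char_eq_1_iff)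
  then show ?thesis by (simp add: expect_def)
qed

subsection \<open>Gowers averages\<close>

text \<open>The average under the root in \<open>gowers_norm\<close>, before the real part is taken.
  At \<open>k = 0\<close> it is the plain mean, in general not real, and the recursion on
  \<open>k\<close> starts there.\<close>

definition gowers_avg :: "nat \<Rightarrow> nat \<Rightarrow> (int \<Rightarrow> complex) \<Rightarrow> complex" where
  "gowers_avg p k f =
     expect (residues_mod p \<times> ({1..k} \<rightarrow>\<^sub>E residues_mod p))
       (\<lambda>(x, h). \<Prod>w \<in> {1..k} \<rightarrow>\<^sub>E {0, 1::nat}.
          (cnj ^^ (\<Sum>j = 1..k. w j)) (f ((x + (\<Sum>j = 1..k. int (w j) * h j)) mod int p)))"

text \<open>The conjugate sits on the shifted factor because a coordinate 1 of \<open>w\<close>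
  causes both a shift and a conjugation.\<close>

definition mult_deriv :: "nat \<Rightarrow> int \<Rightarrow> (int \<Rightarrow> complex) \<Rightarrow> int \<Rightarrow> complex" where
  "mult_deriv p h f y = f y * cnj (f ((y + h) mod int p))"

lemma gowers_norm_eq_root: "gowers_norm p k f = root (2 ^ k) (Re (gowers_avg p k f))"
  by (simp add: gowers_norm_def gowers_avg_def)

lemma bij_betw_PiE_Suc:
  "bij_betw (\<lambda>(a, h). h(Suc k := a)) (B \<times> ({1..k} \<rightarrow>\<^sub>E B)) ({1..Suc k} \<rightarrow>\<^sub>E B)"
proof -
  have "{1..Suc k} = insert (Suc k) {1..k}" by auto
  then show ?thesis
    unfolding bij_betw_def
    using PiE_insert_eq[of "Suc k" "{1..k}" "\<lambda>_. B"] inj_combinator[of "Suc k" "{1..k}" "\<lambda>_. B"]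
    by auto
qed

lemma sum_PiE_Suc:
  "(\<Sum>h \<in> {1..Suc k} \<rightarrow>\<^sub>E B. g h) = (\<Sum>a \<in> B. \<Sum>h \<in> {1..k} \<rightarrow>\<^sub>E B. g (h(Suc k := a)))"
  by (subst sum.reindex_bij_betw[OF bij_betw_PiE_Suc, symmetric])
    (simp add: sum.cartesian_product split_def)

lemma prod_PiE_Suc:
  "(\<Prod>h \<in> {1..Suc k} \<rightarrow>\<^sub>E B. g h) = (\<Prod>a \<in> B. \<Prod>h \<in> {1..k} \<rightarrow>\<^sub>E B. g (h(Suc k := a)))"
  by (subst prod.reindex_bij_betw[OF bij_betw_PiE_Suc, symmetric])
    (simp add: prod.cartesian_product split_def)

lemma cnj_funpow_mult: "(cnj ^^ n) (a * b) = (cnj ^^ n) a * (cnj ^^ n) b"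
  by (induction n) simp_all

lemma gowers_avg_0: "gowers_avg p 0 f = expect (residues_mod p) f"
proof -
  have "(\<Sum>(x, h) \<in> residues_mod p \<times> {\<lambda>_ :: nat. undefined :: int}. f (x mod int p)) =
      (\<Sum>x \<in> residues_mod p. f x)"
    by (simp add: sum.cartesian_product[symmetric])
  then show ?thesis
    by (simp add: gowers_avg_def expect_def card_cartesian_product)
qed

text \<open>Fixing the last direction pairs the cube vertices with last coordinate 0 and 1. Each
  pair contributes a value of the multiplicative derivative in that direction, conjugated according
  to the other \<open>k\<close> coordinates.\<close>

lemma gowers_avg_Suc:
  "gowers_avg p (Suc k) f = expect (residues_mod p) (\<lambda>h. gowers_avg p k (mult_deriv p h f))"
proof -
  let ?R = "residues_mod p"
  let ?B = "{0, 1::nat}"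
  define F where "F k f x h = (\<Prod>w \<in> {1..k} \<rightarrow>\<^sub>E ?B.
    (cnj ^^ (\<Sum>j = 1..k. w j)) (f ((x + (\<Sum>j = 1..k. int (w j) * h j)) mod int p)))"
    for k f x and h :: "nat \<Rightarrow> int"
  have avg: "gowers_avg p k f = (\<Sum>x \<in> ?R. \<Sum>h \<in> {1..k} \<rightarrow>\<^sub>E ?R. F k f x h) / of_nat (p * p ^ k)" for k f
    by (simp add: gowers_avg_def expect_def F_def sum.cartesian_product card_cartesian_product card_PiE)
  have F_Suc: "F (Suc k) f x (h(Suc k := a)) = F k (mult_deriv p a f) x h" for x h a
  proof -
    let ?n = "\<lambda>w. \<Sum>j = 1..k. w j"
    let ?y = "\<lambda>w. x + (\<Sum>j = 1..k. int (w j) * h j)"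
    have 1: "(\<Sum>j = 1..Suc k. (w(Suc k := b)) j) = ?n w + b" for w :: "nat \<Rightarrow> nat" and b
    proof -
      have "(\<Sum>j = 1..k. (w(Suc k := b)) j) = ?n w"
        by (intro sum.cong) auto
      then show ?thesis by simp
    qed
    have 2: "x + (\<Sum>j = 1..Suc k. int ((w(Suc k := b)) j) * (h(Suc k := a)) j) = ?y w + int b * a"
      for w :: "nat \<Rightarrow> nat" and b
    proof -
      have "(\<Sum>j = 1..k. int ((w(Suc k := b)) j) * (h(Suc k := a)) j) = (\<Sum>j = 1..k. int (w j) * h j)"
        by (intro sum.cong) auto
      then show ?thesis by simp
    qed
    have "F (Suc k) f x (h(Suc k := a)) =
        (\<Prod>w \<in> {1..k} \<rightarrow>\<^sub>E ?B. (cnj ^^ ?n w) (f (?y w mod int p))) *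
        (\<Prod>w \<in> {1..k} \<rightarrow>\<^sub>E ?B. (cnj ^^ (?n w + 1)) (f ((?y w + a) mod int p)))"
      unfolding F_def by (subst prod_PiE_Suc) (simp_all only: 1 2, simp_all)
    also have "\<dots> = F k (mult_deriv p a f) x h"
      unfolding F_def prod.distrib[symmetric]
      by (intro prod.cong refl)
        (simp add: mult_deriv_def cnj_funpow_mult funpow_swap1 mod_simps)
    finally show ?thesis .
  qed
  have "(\<Sum>x \<in> ?R. \<Sum>h \<in> {1..Suc k} \<rightarrow>\<^sub>E ?R. F (Suc k) f x h) =
      (\<Sum>x \<in> ?R. \<Sum>a \<in> ?R. \<Sum>h \<in> {1..k} \<rightarrow>\<^sub>E ?R. F k (mult_deriv p a f) x h)"
    by (simp only: sum_PiE_Suc F_Suc)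
  also have "\<dots> = (\<Sum>a \<in> ?R. \<Sum>x \<in> ?R. \<Sum>h \<in> {1..k} \<rightarrow>\<^sub>E ?R. F k (mult_deriv p a f) x h)"
    by (rule sum.swap)
  finally show ?thesis
    by (simp add: avg expect_def sum_divide_distrib field_simps)
qed

text \<open>For fixed \<open>x\<close> the point \<open>x + h\<close> runs through all residues as
  \<open>h\<close> does, so the double sum factors into a sum times its conjugate.\<close>

lemma gowers_avg_1:
  assumes "p > 0"
  shows "gowers_avg p 1 f = of_real (cmod (expect (residues_mod p) f) ^ 2)"
proof -
  let ?R = "residues_mod p"
  have "gowers_avg p 1 f = (\<Sum>h \<in> ?R. \<Sum>x \<in> ?R. f x * cnj (f ((x + h) mod int p))) / (of_nat p * of_nat p)"
    by (simp add: gowers_avg_Suc gowers_avg_0 expect_def mult_deriv_def sum_divide_distrib)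
  also have "(\<Sum>h \<in> ?R. \<Sum>x \<in> ?R. f x * cnj (f ((x + h) mod int p))) =
      (\<Sum>x \<in> ?R. f x * (\<Sum>h \<in> ?R. cnj (f ((h + x) mod int p))))"
    by (subst sum.swap) (simp add: sum_distrib_left add.commute)
  also have "\<dots> = (\<Sum>x \<in> ?R. f x) * cnj (\<Sum>x \<in> ?R. f x)"
    by (simp add: sum_residues_shift[OF assms, where g = "\<lambda>y. cnj (f y)"] sum_distrib_right)
  also have "\<dots> / (of_nat p * of_nat p) = expect ?R f * cnj (expect ?R f)"
    by (simp add: expect_def)
  finally show ?thesis
    by (simp only: complex_norm_square)
qed

text \<open>Monotonicity of the Gowers norms in terms of averages. The case \<open>k = 0\<close> is
  an equality by \<open>gowers_avg_1\<close>; the step applies Cauchy-Schwarz over the last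
  direction and the induction hypothesis to each derivative.\<close>

lemma gowers_avg_mono:
  assumes "p > 0"
  shows "cmod (gowers_avg p k f) ^ 2 \<le> Re (gowers_avg p (Suc k) f)"
proof (induction k arbitrary: f)
  case 0
  show ?case
    using gowers_avg_1[OF assms, of f] by (simp add: gowers_avg_0)
next
  case (Suc k)
  let ?R = "residues_mod p"
  have "cmod (gowers_avg p (Suc k) f) ^ 2 \<le>
      (\<Sum>h \<in> ?R. cmod (gowers_avg p k (mult_deriv p h f)) ^ 2) / card ?R"
    by (subst gowers_avg_Suc) (rule norm_expect_squared_le)
  also have "\<dots> \<le> (\<Sum>h \<in> ?R. Re (gowers_avg p (Suc k) (mult_deriv p h f))) / card ?R"
    by (intro divide_right_mono sum_mono Suc.IH) simp
  also have "\<dots> = Re (gowers_avg p (Suc (Suc k)) f)"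
    by (subst (2) gowers_avg_Suc) (simp add: expect_def)
  finally show ?case .
qed

lemma norm_expect_le:
  assumes "\<And>a. a \<in> A \<Longrightarrow> cmod (g a) \<le> c a"
  shows "cmod (expect A g) \<le> (\<Sum>a \<in> A. c a) / card A"
  unfolding expect_def norm_divide norm_of_nat
  by (intro divide_right_mono sum_norm_le assms) simp_all

text \<open>Derivatives of functions bounded by 1 stay bounded by 1. This trivial bound serves for
  the degenerate direction \<open>h = 0\<close> below.\<close>

lemma norm_gowers_avg_le_1:
  assumes "\<And>y. cmod (f y) \<le> 1"
  shows "cmod (gowers_avg p k f) \<le> 1"
  using assms
proof (induction k arbitrary: f)
  case 0
  have "cmod (expect (residues_mod p) f) \<le> (\<Sum>a \<in> residues_mod p. 1) / card (residues_mod p)"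
    by (intro norm_expect_le 0)
  then show ?case by (cases "p = 0") (simp_all add: gowers_avg_0)
next
  case (Suc k)
  have "cmod (mult_deriv p h f y) \<le> 1" for h y
    unfolding mult_deriv_def norm_mult by (intro mult_le_one) (simp_all add: Suc.prems)
  then have "cmod (gowers_avg p (Suc k) f) \<le> (\<Sum>a \<in> residues_mod p. 1) / card (residues_mod p)"
    unfolding gowers_avg_Suc by (intro norm_expect_le Suc.IH)
  then show ?case by (cases "p = 0") simp_all
qed

subsection \<open>Polynomial phases\<close>

lemma degree_pcompose_shift_le:
  fixes q :: "'a :: idom poly"
  shows "degree (pcompose q [:h, 1:]) \<le> degree q"
  using degree_pcompose_le[of q "[:h, 1:]"] by simp

lemma pcompose_shift_pCons:
  fixes q :: "'a :: comm_ring_1 poly"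
  shows "pcompose (pCons a q) [:h, 1:] = pCons a (pcompose q [:h, 1:]) + smult h (pcompose q [:h, 1:])"
  by (simp add: pcompose_pCons)

lemma coeff_pcompose_shift_top:
  fixes q :: "'a :: idom poly"
  assumes "degree q \<le> n"
  shows "coeff (pcompose q [:h, 1:]) n = coeff q n"
  using assms
proof (induction q arbitrary: n)
  case 0
  show ?case by simp
next
  case (pCons a q)
  show ?case
  proof (cases "q = 0")
    case False
    then obtain n' where n: "n = Suc n'" "degree q \<le> n'"
      using pCons.prems by (cases n) auto
    then have "coeff (pcompose q [:h, 1:]) n = 0"
      using degree_pcompose_shift_le[of q h] by (intro coeff_eq_0) simp
    then show ?thesis
      using n pCons.IH by (simp add: pcompose_shift_pCons)
  qed (simp add: pcompose_pCons)
qed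

text \<open>The binomial expansion of q(y + h) to second order. Together with the unchanged top
  coefficient it shows that q(y) - q(y + h) loses its top term and exposes a multiple of
  \<open>h\<close> times the old one.\<close>

lemma coeff_pcompose_shift_subtop:
  fixes q :: "'a :: idom poly"
  assumes "degree q \<le> Suc n"
  shows "coeff (pcompose q [:h, 1:]) n = coeff q n + of_nat (Suc n) * h * coeff q (Suc n)"
  using assms
proof (induction q arbitrary: n)
  case 0
  show ?case by simp
next
  case (pCons a q)
  show ?case
  proof (cases "q = 0")
    case False
    then have deg: "degree q \<le> n" using pCons.prems by simp
    show ?thesis
    proof (cases n)
      case 0
      then show ?thesis
        using coeff_pcompose_shift_top[OF deg, of h] by (simp add: pcompose_shift_pCons)
    next
      case (Suc m)
      then show ?thesis
        using coeff_pcompose_shift_top[OF deg, of h] pCons.IH[of m] deg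
        by (simp add: pcompose_shift_pCons algebra_simps)
    qed
  qed (simp add: pcompose_pCons)
qed

lemma mult_deriv_poly_phase:
  assumes "p > 0"
  shows "mult_deriv p h (\<lambda>y. add_char p (poly q y)) =
    (\<lambda>y. add_char p (poly (q - pcompose q [:h, 1:]) y))"
  by (rule ext)
    (simp add: mult_deriv_def add_char_poly_mod[OF assms] cnj_add_char add_char_add[symmetric]
      poly_pcompose add.commute)

text \<open>Differentiate down to a linear phase, whose mean is 0. Each level loses only the
  direction \<open>h = 0\<close>, at a cost of at most 1/p, hence d/p after d levels. The bound
  \<open>Suc d < p\<close> keeps the integer factors produced by differentiation invertible mod
  \<open>p\<close>.\<close>

lemma norm_gowers_avg_poly_phase_le:
  assumes "prime p" and "degree q \<le> Suc d" and "\<not> int p dvd coeff q (Suc d)" and "Suc d < p"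
  shows "cmod (gowers_avg p (Suc d) (\<lambda>y. add_char p (poly q y))) \<le> d / p"
  using assms(2-)
proof (induction d arbitrary: q)
  case 0
  have p: "p > 0" using assms(1) by (simp add: prime_gt_0_nat)
  obtain a b where q: "q = [:b, a:]"
  proof (cases q)
    case (pCons b r)
    then have "degree r = 0" using "0.prems"(1) by (cases "r = 0") auto
    with pCons show ?thesis by (auto elim!: degree_eq_zeroE intro: that)
  qed
  have "\<not> int p dvd a" using 0 by (simp add: q)
  then show ?case
    using gowers_avg_1[OF p, of "\<lambda>y. add_char p (poly q y)"] expect_linear_phase[OF p]
    by (simp add: q)
next
  case (Suc d)
  let ?R = "residues_mod p"
  let ?f = "\<lambda>y. add_char p (poly q y)"
  have p: "p > 0" using assms(1) by (simp add: prime_gt_0_nat)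
  have "cmod (gowers_avg p (Suc d) (mult_deriv p h ?f)) \<le> (if h = 0 then 1 else d / p)"
    if h: "h \<in> ?R" for h
  proof (cases "h = 0")
    case True
    then show ?thesis
      by (auto intro!: norm_gowers_avg_le_1 simp: mult_deriv_def norm_mult)
  next
    case False
    let ?q = "q - pcompose q [:h, 1:]"
    have deg: "degree ?q \<le> Suc d"
    proof -
      have "degree ?q \<le> Suc (Suc d)"
        using Suc.prems(1) degree_pcompose_shift_le[of q h] by (intro degree_diff_le) simp_all
      moreover have "coeff ?q (Suc (Suc d)) = 0"
        using coeff_pcompose_shift_top[OF Suc.prems(1)] by simp
      ultimately show ?thesis
        by (metis degree_0 leading_coeff_0_iff le_Suc_eq zero_le)
    qed
    have coeff: "coeff ?q (Suc d) = - (int (Suc (Suc d)) * h * coeff q (Suc (Suc d)))"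
      using coeff_pcompose_shift_subtop[OF Suc.prems(1), of h] by simp
    have "\<not> int p dvd h"
      using h False by (auto dest: zdvd_imp_le)
    moreover have "\<not> int p dvd int (Suc (Suc d))"
      using Suc.prems(3) by (auto dest!: zdvd_imp_le simp del: of_nat_Suc)
    moreover have "prime (int p)" using assms(1) by simp
    \<comment> \<open>All three factors of the new top coefficient are prime to \<open>p\<close>, so
      the induction hypothesis applies with the degree bound lowered by one.\<close>
    ultimately have "\<not> int p dvd coeff ?q (Suc d)"
      unfolding coeff dvd_minus_iff using Suc.prems(2) by (simp only: prime_dvd_mult_iff) simp
    with deg Suc.prems(3) False show ?thesis
      by (simp only: mult_deriv_poly_phase[OF p] if_False) (rule Suc.IH; simp)
  qed
  then have "cmod (gowers_avg p (Suc (Suc d)) ?f) \<le> (\<Sum>h \<in> ?R. if h = 0 then 1 else d / p) / card ?R"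
    by (subst gowers_avg_Suc) (rule norm_expect_le)
  \<comment> \<open>Adding d/p also at \<open>h = 0\<close> is harmless: the total is 1 + p * (d/p)
    = d + 1.\<close>
  also have "(\<Sum>h \<in> ?R. if h = 0 then 1 else d / p) \<le> (\<Sum>h \<in> ?R. (if h = 0 then 1 else 0) + d / p)"
    by (intro sum_mono) simp
  also have "\<dots> = real (Suc d)"
    using p by (simp add: sum.distrib)
  finally show ?case by (simp add: divide_right_mono)
qed

text \<open>Downward induction from \<open>k = degree q\<close>, where the explicit bound applies;
  monotonicity passes from \<open>Suc k\<close> to \<open>k\<close>, using \<epsilon>^2 to obtain
  \<epsilon>. Since \<open>k > 0\<close>, \<open>q\<close> is nonconstant; a constant phase would
  have averages of modulus 1.\<close>

lemma eventually_gowers_avg_poly_phase_small: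
  fixes q :: "int poly"
  assumes "k \<le> degree q" and "k > 0" and "\<epsilon> > 0"
  shows "\<exists>p0. \<forall>p > p0. prime p \<longrightarrow> cmod (gowers_avg p k (\<lambda>y. add_char p (poly q y))) < \<epsilon>"
  using assms
proof (induction k arbitrary: \<epsilon> rule: inc_induct)
  case base
  then obtain d where d: "degree q = Suc d" by (cases "degree q") auto
  obtain p1 :: nat where p1: "real d / \<epsilon> < p1" using reals_Archimedean2 by blast
  show ?case
  \<comment> \<open>The three thresholds give d/p < \<epsilon>, \<open>Suc d < p\<close>, and a
    leading coefficient not divisible by \<open>p\<close>.\<close>
  proof (intro exI[of _ "max p1 (max (Suc d) (nat \<bar>lead_coeff q\<bar>))"] allI impI)
    fix p assume p: "p > max p1 (max (Suc d) (nat \<bar>lead_coeff q\<bar>))" "prime p"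
    have "lead_coeff q \<noteq> 0" using d by (metis degree_0 leading_coeff_0_iff nat.distinct(1))
    moreover have "\<bar>lead_coeff q\<bar> < int p" using p by auto
    ultimately have "\<not> int p dvd coeff q (Suc d)"
      using d by (auto dest: dvd_imp_le_int)
    then have "cmod (gowers_avg p (Suc d) (\<lambda>y. add_char p (poly q y))) \<le> d / p"
      using p d by (intro norm_gowers_avg_poly_phase_le) auto
    also have "real d / \<epsilon> < real p" using p1 p by linarith
    then have "d / p < \<epsilon>"
      using base p by (simp add: field_simps)
    finally show "cmod (gowers_avg p (degree q) (\<lambda>y. add_char p (poly q y))) < \<epsilon>"
      using d by simp
  qed
next
  case (step k)
  then obtain p0 where p0: "\<And>p. p > p0 \<Longrightarrow> prime p \<Longrightarrow>
      cmod (gowers_avg p (Suc k) (\<lambda>y. add_char p (poly q y))) < \<epsilon> ^ 2"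
    by (meson zero_less_Suc zero_less_power)
  show ?case
  proof (intro exI[of _ p0] allI impI)
    fix p assume p: "p > p0" "prime p"
    let ?f = "\<lambda>y. add_char p (poly q y)"
    have "cmod (gowers_avg p k ?f) ^ 2 \<le> Re (gowers_avg p (Suc k) ?f)"
      using p by (intro gowers_avg_mono) simp
    also have "\<dots> \<le> cmod (gowers_avg p (Suc k) ?f)" by (rule complex_Re_le_cmod)
    also have "\<dots> < \<epsilon> ^ 2" by (rule p0[OF p])
    finally show "cmod (gowers_avg p k ?f) < \<epsilon>"
      using step.prems by (simp add: power_less_imp_less_base)
  qed
qed

lemma eventually_gowers_norm_poly_phase_small:
  fixes q :: "int poly"
  assumes "k \<le> degree q" and "k > 0" and "\<delta> > 0"
  shows "\<exists>p0. \<forall>p > p0. prime p \<longrightarrow> gowers_norm p k (\<lambda>y. add_char p (poly q y)) < \<delta>"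
proof -
  have "\<delta> ^ (2 ^ k) > 0" using assms by simp
  then obtain p0 where p0: "\<And>p. p > p0 \<Longrightarrow> prime p \<Longrightarrow>
      cmod (gowers_avg p k (\<lambda>y. add_char p (poly q y))) < \<delta> ^ (2 ^ k)"
    using eventually_gowers_avg_poly_phase_small[OF assms(1,2)] by meson
  show ?thesis
  proof (intro exI[of _ p0] allI impI)
    fix p assume p: "p > p0" "prime p"
    let ?f = "\<lambda>y. add_char p (poly q y)"
    have "Re (gowers_avg p k ?f) < \<delta> ^ (2 ^ k)"
      using complex_Re_le_cmod[of "gowers_avg p k ?f"] p0[OF p] by linarith
    then have "gowers_norm p k ?f < root (2 ^ k) (\<delta> ^ (2 ^ k))"
      unfolding gowers_norm_eq_root by (intro real_root_less_mono) simp_all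
    also have "\<dots> = \<delta>" using assms by (intro real_root_power_cancel) simp_all
    finally show "gowers_norm p k ?f < \<delta>" .
  qed
qed

section \<open>From an algebraic relation to a lower bound on true complexity\<close>

lemma expect_phases_of_relation:
  assumes "integral_polynomial_map D t P"
    and "(\<Sum>j = 1..t. poly (map_poly of_int (Q j)) (P j)) = 0"
    and "p > 0"
  shows "expect ({1..D} \<rightarrow>\<^sub>E residues_mod p)
      (\<lambda>x. \<Prod>j = 1..t. add_char p (poly (Q j) (value_mod p (P j) x))) = 1"
proof -
  have "(\<Prod>j = 1..t. add_char p (poly (Q j) (value_mod p (P j) x))) = 1" for x
  proof -
    have "(\<Prod>j = 1..t. add_char p (poly (Q j) (value_mod p (P j) x))) =
        add_char p (\<Sum>j = 1..t. poly (Q j) \<lfloor>mpoly_eval (\<lambda>v. of_int (x v)) (P j)\<rfloor>)"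
      \<comment> \<open>Integer polynomials respect congruence, so the reduction mod
        \<open>p\<close> in \<open>value_mod\<close> does not change the phase.\<close>
      by (simp add: value_mod_def add_char_poly_mod[OF assms(3)] add_char_sum)
    also have "\<dots> = 1"
      using assms(1,2)
      by (subst relation_at_integer_point) (auto simp: integral_polynomial_map_def)
    finally show ?thesis .
  qed
  then show ?thesis
    using assms(3) by (simp add: expect_def card_PiE)
qed

lemma not_gowers_controlled_below_relation_degree:
  assumes "integral_polynomial_map D t P"
    and "(\<Sum>j = 1..t. poly (map_poly of_int (Q j)) (P j)) = 0"
    and "r < degree (Q i)"
  shows "\<not> gowers_controlled_at D t P i r"
proof
  assume "gowers_controlled_at D t P i r"
  \<comment> \<open>The choice \<epsilon> = 1 suffices, because the average of the phases is exactly
    1 for every prime.\<close>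
  then obtain \<delta> p0 where \<delta>: "\<delta> > 0" and controlled: "\<And>p f. p > p0 \<Longrightarrow> prime p \<Longrightarrow>
      (\<forall>j \<in> {1..t}. one_bounded p (f j)) \<Longrightarrow> gowers_norm p (r + 1) (f i) < \<delta> \<Longrightarrow>
      cmod (expect ({1..D} \<rightarrow>\<^sub>E residues_mod p) (\<lambda>x. \<Prod>j = 1..t. f j (value_mod p (P j) x))) < 1"
    unfolding gowers_controlled_at_def by (meson zero_less_one)
  obtain p1 where p1: "\<And>p. p > p1 \<Longrightarrow> prime p \<Longrightarrow>
      gowers_norm p (r + 1) (\<lambda>y. add_char p (poly (Q i) y)) < \<delta>"
    using eventually_gowers_norm_poly_phase_small[of "r + 1" "Q i" \<delta>] assms(3) \<delta> by auto
  obtain p where p: "prime p" "p > max p0 p1"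
    using bigger_prime by blast
  have "cmod (expect ({1..D} \<rightarrow>\<^sub>E residues_mod p)
      (\<lambda>x. \<Prod>j = 1..t. add_char p (poly (Q j) (value_mod p (P j) x)))) < 1"
    using p p1[of p] by (intro controlled) (auto simp: one_bounded_def)
  moreover have "p > 0" using p by simp
  ultimately show False
    using expect_phases_of_relation[OF assms(1,2)] by simp
qed

theorem theorem1p13:
  fixes D t s i :: nat and P :: "nat \<Rightarrow> rat_mpoly"
  assumes "integral_polynomial_map D t P"
    and "1 \<le> i" and "i \<le> t"
    and "\<not> alg_independent_at t P s i"
  shows "true_complexity D t P i \<ge> enat s"
proof -
  \<comment> \<open>Negating the integer inequality yields \<open>s \<le> degree (Q i)\<close>, also
    for \<open>s = 0\<close>, where the bound \<open>int s - 1\<close> is -1.\<close>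
  obtain Q :: "nat \<Rightarrow> int poly" where
    rel: "(\<Sum>j = 1..t. poly (map_poly of_int (Q j)) (P j)) = 0" and deg: "s \<le> degree (Q i)"
    using assms(4) unfolding alg_independent_at_def by force
  have "s \<le> r" if "gowers_controlled_at D t P i r" for r
    using not_gowers_controlled_below_relation_degree[OF assms(1) rel, of r i] that deg by fastforce
  \<comment> \<open>Either the least controlling \<open>r\<close> exists and is at least
    \<open>s\<close>, or the true complexity is infinite.\<close>
  then show ?thesis
    unfolding true_complexity_def by (auto intro: LeastI2_ex)
qed

end
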